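(* Let $\Bbbk$ be a field, let $a,e\in\Bbbk$ be nonzero, and let $b=-1$. Suppose $b^2\neq ae$. Let $V_{abe}$ be the braided vector space with basis $v_1,v_2$ and braiding $c(v_1\otimes v_1)=a\,v_2\otimes v_2$, $c(v_1\otimes v_2)=b\,v_1\otimes v_2$, $c(v_2\otimes v_1)=b\,v_2\otimes v_1$, $c(v_2\otimes v_2)=e\,v_1\otimes v_1$. If $ae$ is a primitive $m$-th root of unity for some $m\geq 1$, then the Nichols algebra $\mathfrak{B}(V_{abe})$ is finite dimensional, and $\dim_{\Bbbk}\mathfrak{B}(V_{abe})=4m$.
   Context: For a braided vector space $(V,c)$, let $c_i$ be the endomorphism of $V^{\otimes n}$ acting as $c$ on the tensor factors $i,i+1$ and as the identity elsewhere. Define $\mathfrak{S}_{n,1}=\mathrm{id}+c_n+c_{n-1}c_n+\cdots+c_1\cdots c_{n-1}c_n\in\mathrm{End}(V^{\otimes(n+1)})$, $\mathfrak{S}_1=\mathrm{id}$, and $\mathfrak{S}_n=\mathfrak{S}_{n-1,1}(\mathfrak{S}_{n-1}\otimes\mathrm{id})\in\mathrm{End}(V^{\otimes n})$ (so $\mathfrak{S}_2=\mathrm{id}+c$). The Nichols algebra of $(V,c)$ is the graded algebra $\mathfrak{B}(V)=\Bbbk\oplus V\oplus\bigoplus_{n\geq 2}V^{\otimes n}/\ker\mathfrak{S}_n$, a quotient of the tensor algebra $T(V)$. *)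

theory Defs
  imports "HOL-Algebra.QuotRing" "Jordan_Normal_Form.VS_Connect"
begin

text \<open>
  The space \<open>V\<close> has a finite basis \<open>(v\<^sub>i)\<close> indexed by the type \<open>'i\<close>.  The tensor algebra \<open>T(V)\<close> is
  modelled on its monomial basis: a finitely supported \<open>f :: 'i list \<Rightarrow> 'k\<close> stands for the sum of
  \<open>f [i\<^sub>1,\<dots>,i\<^sub>n] v\<^bsub>i\<^sub>1\<^esub> \<otimes> \<dots> \<otimes> v\<^bsub>i\<^sub>n\<^esub>\<close> over all words, and \<open>V\<close> tensored with itself is the space of
  functions \<open>'i \<times> 'i \<Rightarrow> 'k\<close>.
\<close>

definition tensor_algebra :: "('k::field, 'i list \<Rightarrow> 'k) module" where
  "tensor_algebra =
    \<lparr> carrier = {f. finite {w. f w \<noteq> 0}},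
      mult = (\<lambda>f g w. \<Sum>n\<le>length w. f (take n w) * g (drop n w)),
      one = (\<lambda>w. if w = [] then 1 else 0),
      zero = (\<lambda>w. 0),
      add = (\<lambda>f g w. f w + g w),
      smult = (\<lambda>r f w. r * f w) \<rparr>"

definition tensor_power :: "nat \<Rightarrow> ('i::finite list \<Rightarrow> 'k::field) set" where
  "tensor_power n = {f. \<forall>w. f w \<noteq> 0 \<longrightarrow> length w = n}"

definition homogeneous_part :: "nat \<Rightarrow> ('i list \<Rightarrow> 'k::field) \<Rightarrow> 'i list \<Rightarrow> 'k" where
  "homogeneous_part n f = (\<lambda>w. if length w = n then f w else 0)"

definition linear_operator :: "(('a \<Rightarrow> 'k::field) \<Rightarrow> 'b \<Rightarrow> 'k) \<Rightarrow> bool" where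
  "linear_operator A \<longleftrightarrow>
    (\<forall>f g. A (\<lambda>x. f x + g x) = (\<lambda>y. A f y + A g y)) \<and>
    (\<forall>r f. A (\<lambda>x. r * f x) = (\<lambda>y. r * A f y))"

type_synonym ('i, 'k) braiding = "('i \<times> 'i \<Rightarrow> 'k) \<Rightarrow> 'i \<times> 'i \<Rightarrow> 'k"

text \<open>
  \<open>braid_at c n i\<close>, for \<open>1 \<le> i < n\<close>, is the endomorphism \<open>c\<^sub>i\<close> of the \<open>n\<close>-th tensor power.  The tensor
  factors are counted from \<open>1\<close>, list positions from \<open>0\<close>.
\<close>

definition braid_at ::
  "('i::finite, 'k::field) braiding \<Rightarrow> nat \<Rightarrow> nat \<Rightarrow> ('i list \<Rightarrow> 'k) \<Rightarrow> 'i list \<Rightarrow> 'k" where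
  "braid_at c n i f = (\<lambda>w.
    if length w = n then c (\<lambda>(k, l). f (w[i - 1 := k, i := l])) (w ! (i - 1), w ! i) else 0)"

definition braided_vector_space :: "('i::finite, 'k::field) braiding \<Rightarrow> bool" where
  "braided_vector_space c \<longleftrightarrow> linear_operator c \<and> bij c \<and>
    (\<forall>f \<in> tensor_power 3.
      braid_at c 3 1 (braid_at c 3 2 (braid_at c 3 1 f)) =
      braid_at c 3 2 (braid_at c 3 1 (braid_at c 3 2 f)))"

text \<open>
  \<open>quantum_shuffle c n\<close> is \<open>id + c\<^sub>n + c\<^bsub>n-1\<^esub> c\<^sub>n + \<dots> + c\<^sub>1 \<dots> c\<^bsub>n-1\<^esub> c\<^sub>n\<close> on the tensor power of degree
  \<open>n + 1\<close>; the \<open>i\<close>-th summand is \<open>c\<^sub>i \<dots> c\<^sub>n\<close>, with \<open>c\<^sub>n\<close> applied first.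
\<close>

definition quantum_shuffle ::
  "('i::finite, 'k::field) braiding \<Rightarrow> nat \<Rightarrow> ('i list \<Rightarrow> 'k) \<Rightarrow> 'i list \<Rightarrow> 'k" where
  "quantum_shuffle c n f = (\<lambda>w. f w + (\<Sum>i = 1..n. foldr (braid_at c (n + 1)) [i..<n + 1] f w))"

text \<open>\<open>tensor_id A\<close> is \<open>A \<otimes> id\<close> with \<open>id\<close> acting on the last tensor factor.\<close>

definition tensor_id ::
  "(('i list \<Rightarrow> 'k::field) \<Rightarrow> 'i list \<Rightarrow> 'k) \<Rightarrow> ('i list \<Rightarrow> 'k) \<Rightarrow> 'i list \<Rightarrow> 'k" where
  "tensor_id A f = (\<lambda>w. if w = [] then 0 else A (\<lambda>u. f (u @ [last w])) (butlast w))"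

fun quantum_symmetrizer ::
  "('i::finite, 'k::field) braiding \<Rightarrow> nat \<Rightarrow> ('i list \<Rightarrow> 'k) \<Rightarrow> 'i list \<Rightarrow> 'k" where
  "quantum_symmetrizer c 0 = id"
| "quantum_symmetrizer c (Suc 0) = id"
| "quantum_symmetrizer c (Suc (Suc n)) =
     quantum_shuffle c (Suc n) \<circ> tensor_id (quantum_symmetrizer c (Suc n))"

text \<open>The direct sum of the kernels of the quantum symmetrizers on all tensor powers.\<close>

definition nichols_ideal :: "('i::finite, 'k::field) braiding \<Rightarrow> ('i list \<Rightarrow> 'k) set" where
  "nichols_ideal c = {f \<in> carrier tensor_algebra.
     \<forall>n. quantum_symmetrizer c n (homogeneous_part n f) = (\<lambda>w. 0)}"

text \<open>
  The factor ring of the tensor algebra, as a module over the ground field with scalar multiplication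
  \<open>r (I + f) = I + r f\<close>.
\<close>

definition nichols_algebra ::
  "('i::finite, 'k::field) braiding \<Rightarrow> ('k, ('i list \<Rightarrow> 'k) set) module" where
  "nichols_algebra c =
    ring.extend (tensor_algebra Quot nichols_ideal c)
      (module.fields (\<lambda>r X. \<Union>f\<in>X.
        a_r_coset tensor_algebra (nichols_ideal c) (r \<odot>\<^bsub>tensor_algebra\<^esub> f)))"

subsection \<open>The braided vector spaces \<open>V\<^bsub>abe\<^esub>\<close>\<close>

datatype index2 = I1 | I2

lemma UNIV_index2: "UNIV = {I1, I2}"
  using index2.exhaust by auto

instance index2 :: finite
  by standard (simp add: UNIV_index2)

definition basis_tensor :: "'i \<Rightarrow> 'i \<Rightarrow> 'i \<times> 'i \<Rightarrow> 'k::field" where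
  "basis_tensor i j = (\<lambda>p. if p = (i, j) then 1 else 0)"

fun abe_on_basis :: "'k::field \<Rightarrow> 'k \<Rightarrow> 'k \<Rightarrow> index2 \<Rightarrow> index2 \<Rightarrow> index2 \<times> index2 \<Rightarrow> 'k" where
  "abe_on_basis a b e I1 I1 = (\<lambda>p. a * basis_tensor I2 I2 p)"
| "abe_on_basis a b e I1 I2 = (\<lambda>p. b * basis_tensor I1 I2 p)"
| "abe_on_basis a b e I2 I1 = (\<lambda>p. b * basis_tensor I2 I1 p)"
| "abe_on_basis a b e I2 I2 = (\<lambda>p. e * basis_tensor I1 I1 p)"

text \<open>The linear extension of the values on the basis.\<close>

definition braiding_abe :: "'k::field \<Rightarrow> 'k \<Rightarrow> 'k \<Rightarrow> (index2, 'k) braiding" where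
  "braiding_abe a b e t = (\<lambda>p. \<Sum>(i, j)\<in>UNIV. t (i, j) * abe_on_basis a b e i j p)"

definition primitive_root_of_unity :: "nat \<Rightarrow> 'k::field \<Rightarrow> bool" where
  "primitive_root_of_unity m x \<longleftrightarrow> m \<ge> 1 \<and> x ^ m = 1 \<and> (\<forall>k. 1 \<le> k \<and> k < m \<longrightarrow> x ^ k \<noteq> 1)"

subsection \<open>Well-definedness\<close>

lemma braiding_abe_apply:
  "braiding_abe a b e t (I1, I1) = e * t (I2, I2)"
  "braiding_abe a b e t (I1, I2) = b * t (I1, I2)"
  "braiding_abe a b e t (I2, I1) = b * t (I2, I1)"
  "braiding_abe a b e t (I2, I2) = a * t (I1, I1)"
  by (simp_all add: braiding_abe_def UNIV_index2 basis_tensor_def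
      UNIV_Times_UNIV[symmetric] sum.cartesian_product[symmetric] del: UNIV_Times_UNIV)

lemma braiding_abe_basis:
  "braiding_abe a b e (basis_tensor i j) = abe_on_basis a b e i j"
proof
  fix p show "braiding_abe a b e (basis_tensor i j) p = abe_on_basis a b e i j p"
    by (cases p; cases "fst p"; cases "snd p"; cases i; cases j)
       (auto simp: braiding_abe_apply basis_tensor_def)
qed

lemma braided_vector_space_abe:
  assumes "a \<noteq> 0" "b \<noteq> 0" "e \<noteq> 0"
  shows "braided_vector_space (braiding_abe a b e)"
proof -
  have ext2: "s = t" if "s (I1,I1) = t (I1,I1)" "s (I1,I2) = t (I1,I2)"
    "s (I2,I1) = t (I2,I1)" "s (I2,I2) = t (I2,I2)" for s t :: "index2 \<times> index2 \<Rightarrow> 'a"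
  proof
    show "s p = t p" for p
      using that by (cases p; cases "fst p"; cases "snd p") simp_all
  qed
  show ?thesis
    unfolding braided_vector_space_def
  proof (intro conjI ballI)
    show "linear_operator (braiding_abe a b e)"
      unfolding linear_operator_def
      by (intro conjI allI; rule ext2; simp only: braiding_abe_apply; simp add: distrib_left mult.left_commute)
  next
    have inv: "braiding_abe a b e (braiding_abe (inverse e) (inverse b) (inverse a) t) = t"
      "braiding_abe (inverse e) (inverse b) (inverse a) (braiding_abe a b e t) = t" for t
      using assms by (rule_tac [!] ext2) (simp_all add: braiding_abe_apply)
    show "bij (braiding_abe a b e)"
      by (rule o_bij[of "braiding_abe (inverse e) (inverse b) (inverse a)"])
         (rule ext, simp only: o_apply id_apply inv)+
  next
    fix f :: "index2 list \<Rightarrow> 'a"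
    let ?c = "braid_at (braiding_abe a b e) 3"
    have c1: "?c 1 g [i, j, k] = braiding_abe a b e (\<lambda>(i, j). g [i, j, k]) (i, j)"
      and c2: "?c 2 g [i, j, k] = braiding_abe a b e (\<lambda>(j, k). g [i, j, k]) (j, k)" for g i j k
      by (simp_all add: braid_at_def case_prod_unfold)
    show "?c 1 (?c 2 (?c 1 f)) = ?c 2 (?c 1 (?c 2 f))"
    proof
      fix w :: "index2 list"
      show "?c 1 (?c 2 (?c 1 f)) w = ?c 2 (?c 1 (?c 2 f)) w"
      proof (cases "length w = 3")
        case True
        then obtain i j k where "w = [i, j, k]"
          by (auto simp: numeral_3_eq_3 length_Suc_conv)
        then show ?thesis
          by (cases i; cases j; cases k; simp only: c1 c2 braiding_abe_apply prod.case mult_ac)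
      qed (simp add: braid_at_def)
    qed
  qed
qed

lemma linear_operator_braid_at: "linear_operator c \<Longrightarrow> linear_operator (braid_at c n i)"
  unfolding linear_operator_def braid_at_def
  by (auto simp: fun_eq_iff case_prod_unfold)

lemma linear_operator_foldr: "(\<And>i. linear_operator (A i)) \<Longrightarrow> linear_operator (foldr A is)"
  by (induction "is") (auto simp: linear_operator_def)

lemma linear_operator_comp: "linear_operator A \<Longrightarrow> linear_operator B \<Longrightarrow> linear_operator (A \<circ> B)"
  by (simp add: linear_operator_def)

lemma linear_operator_quantum_shuffle: "linear_operator c \<Longrightarrow> linear_operator (quantum_shuffle c n)"
proof -
  assume c: "linear_operator c"
  have "linear_operator (foldr (braid_at c (n + 1)) is)" for "is"
    by (intro linear_operator_foldr linear_operator_braid_at c)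
  then have *: "foldr (braid_at c (n + 1)) is (\<lambda>x. f x + g x) =
      (\<lambda>y. foldr (braid_at c (n + 1)) is f y + foldr (braid_at c (n + 1)) is g y)"
    "foldr (braid_at c (n + 1)) is (\<lambda>x. r * f x) = (\<lambda>y. r * foldr (braid_at c (n + 1)) is f y)"
    for "is" f g r
    unfolding linear_operator_def by blast+
  show ?thesis
    unfolding linear_operator_def quantum_shuffle_def *
    by (simp add: sum.distrib sum_distrib_left[symmetric] distrib_left add_ac)
qed

lemma linear_operator_tensor_id: "linear_operator A \<Longrightarrow> linear_operator (tensor_id A)"
  unfolding linear_operator_def tensor_id_def by (auto simp: fun_eq_iff)

lemma linear_operator_quantum_symmetrizer:
  assumes "linear_operator c" shows "linear_operator (quantum_symmetrizer c n)"
  using assms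
proof (induction c n rule: quantum_symmetrizer.induct)
  case (3 c n)
  then show ?case
    unfolding quantum_symmetrizer.simps
    by (intro linear_operator_comp linear_operator_quantum_shuffle linear_operator_tensor_id) auto
qed (simp_all add: linear_operator_def)

lemma vectorspace_tensor_algebra:
  "vectorspace class_ring (tensor_algebra :: ('k::field, 'i list \<Rightarrow> 'k) module)"
proof -
  let ?T = "tensor_algebra :: ('k::field, 'i list \<Rightarrow> 'k) module"
  have fin: "finite {w. f w + g w \<noteq> 0}"
    if "finite {w. f w \<noteq> 0}" "finite {w. g w \<noteq> 0}" for f g :: "'i list \<Rightarrow> 'k"
    by (rule finite_subset[OF _ finite_UnI[OF that]]) auto
  have finm: "finite {w. r * f w \<noteq> 0}" if "finite {w. f w \<noteq> 0}" for r and f :: "'i list \<Rightarrow> 'k"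
    by (rule finite_subset[OF _ that]) auto
  have "abelian_group ?T"
  proof (rule abelian_groupI)
    fix f assume "f \<in> carrier ?T"
    then show "\<exists>g\<in>carrier ?T. g \<oplus>\<^bsub>?T\<^esub> f = \<zero>\<^bsub>?T\<^esub>"
      by (intro bexI[of _ "\<lambda>w. - f w"]) (simp_all add: tensor_algebra_def)
  qed (auto simp: tensor_algebra_def fin algebra_simps)
  then show ?thesis
    unfolding vectorspace_def
    by (intro conjI moduleI class_field.field_axioms fieldE(1)[OF class_field.field_axioms])
       (simp_all add: tensor_algebra_def finm algebra_simps)
qed

lemma nichols_algebra_simps:
  "carrier (nichols_algebra c) = a_rcosets\<^bsub>tensor_algebra\<^esub> (nichols_ideal c)"
  "add (nichols_algebra c) = set_add tensor_algebra"
  "zero (nichols_algebra c) = nichols_ideal c"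
  "smult (nichols_algebra c) =
    (\<lambda>r X. \<Union>f\<in>X. a_r_coset tensor_algebra (nichols_ideal c) (smult tensor_algebra r f))"
  by (simp_all add: nichols_algebra_def FactRing_def ring.extend_def module.fields_def)

lemma vectorspace_nichols_algebra:
  fixes c :: "('i::finite, 'k::field) braiding"
  assumes "linear_operator c"
  shows "vectorspace class_ring (nichols_algebra c)"
proof -
  let ?T = "tensor_algebra :: ('k, 'i list \<Rightarrow> 'k) module"
  let ?I = "nichols_ideal c"
  let ?N = "nichols_algebra c"
  interpret T: vectorspace class_ring ?T
    by (rule vectorspace_tensor_algebra)
  have hom_add: "homogeneous_part n (\<lambda>x. f x + g x) = (\<lambda>x. homogeneous_part n f x + homogeneous_part n g x)"
    and hom_smult: "homogeneous_part n (\<lambda>x. r * f x) = (\<lambda>x. r * homogeneous_part n f x)"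
    for n r and f g :: "'i list \<Rightarrow> 'k"
    by (auto simp: homogeneous_part_def)
  have S_add: "quantum_symmetrizer c n (\<lambda>x. f x + g x) =
      (\<lambda>y. quantum_symmetrizer c n f y + quantum_symmetrizer c n g y)"
    and S_smult: "quantum_symmetrizer c n (\<lambda>x. r * f x) = (\<lambda>y. r * quantum_symmetrizer c n f y)"
    for n r and f g :: "'i list \<Rightarrow> 'k"
    using linear_operator_quantum_symmetrizer[OF assms, of n] unfolding linear_operator_def by blast+
  have I_sub: "?I \<subseteq> carrier ?T"
    by (auto simp: nichols_ideal_def)
  have I_add: "f \<oplus>\<^bsub>?T\<^esub> g \<in> ?I" if "f \<in> ?I" "g \<in> ?I" for f g
  proof -
    have "f \<oplus>\<^bsub>?T\<^esub> g \<in> carrier ?T"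
      using that I_sub by auto
    then show ?thesis
      using that by (simp add: nichols_ideal_def) (simp add: tensor_algebra_def hom_add S_add)
  qed
  have I_smult: "r \<odot>\<^bsub>?T\<^esub> f \<in> ?I" if "f \<in> ?I" for r f
  proof -
    have "r \<odot>\<^bsub>?T\<^esub> f \<in> carrier ?T"
      using that I_sub by (intro T.smult_closed) auto
    then show ?thesis
      using that by (simp add: nichols_ideal_def) (simp add: tensor_algebra_def hom_smult S_smult)
  qed
  have I_zero: "\<zero>\<^bsub>?T\<^esub> \<in> ?I"
  proof -
    have "quantum_symmetrizer c n (\<lambda>w. 0) = (\<lambda>w. 0)" for n
      using S_smult[of n 0 "\<lambda>w. 0"] by simp
    then show ?thesis
      by (simp add: nichols_ideal_def) (simp add: tensor_algebra_def homogeneous_part_def)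
  qed
  have I_inv: "\<ominus>\<^bsub>?T\<^esub> f \<in> ?I" if "f \<in> ?I" for f
  proof -
    have f: "f \<in> carrier ?T" using that I_sub by auto
    have m: "(- 1) \<odot>\<^bsub>?T\<^esub> f \<in> ?I" by (rule I_smult[OF that])
    have "(- 1) \<odot>\<^bsub>?T\<^esub> f \<oplus>\<^bsub>?T\<^esub> f = \<zero>\<^bsub>?T\<^esub>"
      by (simp add: tensor_algebra_def)
    then have "\<ominus>\<^bsub>?T\<^esub> f = (- 1) \<odot>\<^bsub>?T\<^esub> f"
      using f m I_sub by (intro T.minus_equality) auto
    with m show ?thesis by simp
  qed
  have "additive_subgroup ?I ?T"
    by (intro additive_subgroup.intro subgroup.intro)
       (use I_sub I_add I_zero I_inv in \<open>auto simp: a_inv_def\<close>)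
  then interpret I: abelian_subgroup ?I ?T
    by (rule abelian_subgroupI3) (rule T.abelian_group_axioms)
  have carrierE: "\<exists>f\<in>carrier ?T. X = a_r_coset ?T ?I f" if "X \<in> carrier ?N" for X
    using that by (auto simp: nichols_algebra_simps A_RCOSETS_def')
  have carrierI: "a_r_coset ?T ?I f \<in> carrier ?N" if "f \<in> carrier ?T" for f
    using that by (auto simp: nichols_algebra_simps A_RCOSETS_def')
  have add: "a_r_coset ?T ?I f \<oplus>\<^bsub>?N\<^esub> a_r_coset ?T ?I g = a_r_coset ?T ?I (f \<oplus>\<^bsub>?T\<^esub> g)"
    if "f \<in> carrier ?T" "g \<in> carrier ?T" for f g
    using that by (simp add: nichols_algebra_simps I.a_rcos_sum)
  have smult_T: "r \<odot>\<^bsub>?T\<^esub> f \<in> carrier ?T" if "f \<in> carrier ?T" for r f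
    using that by (intro T.smult_closed) auto
  have smult: "r \<odot>\<^bsub>?N\<^esub> a_r_coset ?T ?I f = a_r_coset ?T ?I (r \<odot>\<^bsub>?T\<^esub> f)"
    if f: "f \<in> carrier ?T" for r f
  proof -
    have const: "a_r_coset ?T ?I (r \<odot>\<^bsub>?T\<^esub> g) = a_r_coset ?T ?I (r \<odot>\<^bsub>?T\<^esub> f)"
      if "g \<in> a_r_coset ?T ?I f" for g
    proof -
      from that obtain h where h: "h \<in> ?I" "g = h \<oplus>\<^bsub>?T\<^esub> f"
        by (auto simp: a_r_coset_def')
      then have "r \<odot>\<^bsub>?T\<^esub> g = r \<odot>\<^bsub>?T\<^esub> h \<oplus>\<^bsub>?T\<^esub> r \<odot>\<^bsub>?T\<^esub> f"
        by (simp add: tensor_algebra_def distrib_left)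
      then have "r \<odot>\<^bsub>?T\<^esub> g \<in> a_r_coset ?T ?I (r \<odot>\<^bsub>?T\<^esub> f)"
        using I_smult[OF h(1)] by (auto simp: a_r_coset_def')
      then show ?thesis
        using I.a_repr_independence' smult_T[OF f] by blast
    qed
    show ?thesis
      unfolding nichols_algebra_simps
      by (rule UN_constant_eq[OF I.a_rcos_self[OF f]]) (intro ballI const)
  qed
  have "abelian_group ?N"
  proof (rule abelian_groupI)
    show "X \<oplus>\<^bsub>?N\<^esub> Y \<in> carrier ?N" if "X \<in> carrier ?N" "Y \<in> carrier ?N" for X Y
      using that by (auto simp: nichols_algebra_simps I.a_setmult_closed)
    show "\<zero>\<^bsub>?N\<^esub> \<in> carrier ?N"
      by (simp add: nichols_algebra_simps I.a_subgroup_in_rcosets)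
    show "X \<oplus>\<^bsub>?N\<^esub> Y \<oplus>\<^bsub>?N\<^esub> Z = X \<oplus>\<^bsub>?N\<^esub> (Y \<oplus>\<^bsub>?N\<^esub> Z)"
      if "X \<in> carrier ?N" "Y \<in> carrier ?N" "Z \<in> carrier ?N" for X Y Z
      using that by (simp add: nichols_algebra_simps I.a_rcosets_assoc)
    show "X \<oplus>\<^bsub>?N\<^esub> Y = Y \<oplus>\<^bsub>?N\<^esub> X" if "X \<in> carrier ?N" "Y \<in> carrier ?N" for X Y
      using carrierE[OF that(1)] carrierE[OF that(2)] by (auto simp: add T.a_comm)
    show "\<zero>\<^bsub>?N\<^esub> \<oplus>\<^bsub>?N\<^esub> X = X" if "X \<in> carrier ?N" for X
      using that by (simp add: nichols_algebra_simps I.rcosets_add_eq)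
    show "\<exists>Y\<in>carrier ?N. Y \<oplus>\<^bsub>?N\<^esub> X = \<zero>\<^bsub>?N\<^esub>" if "X \<in> carrier ?N" for X
      using that I.a_setinv_closed I.a_rcosets_inv_mult_group_eq by (auto simp: nichols_algebra_simps)
  qed
  then have "module class_ring ?N"
  proof (intro moduleI fieldE(1)[OF class_field.field_axioms])
    fix r s X Y
    assume X: "X \<in> carrier ?N"
    then obtain f where f: "f \<in> carrier ?T" "X = a_r_coset ?T ?I f" using carrierE by blast
    show "r \<odot>\<^bsub>?N\<^esub> X \<in> carrier ?N"
      using f by (simp add: smult carrierI smult_T)
    show "(r \<oplus>\<^bsub>class_ring\<^esub> s) \<odot>\<^bsub>?N\<^esub> X = r \<odot>\<^bsub>?N\<^esub> X \<oplus>\<^bsub>?N\<^esub> s \<odot>\<^bsub>?N\<^esub> X"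
      using f T.smult_l_distr[of r s f] by (simp add: smult add smult_T)
    show "(r \<otimes>\<^bsub>class_ring\<^esub> s) \<odot>\<^bsub>?N\<^esub> X = r \<odot>\<^bsub>?N\<^esub> (s \<odot>\<^bsub>?N\<^esub> X)"
      using f T.smult_assoc1[of r s f] by (simp add: smult smult_T)
    show "\<one>\<^bsub>class_ring\<^esub> \<odot>\<^bsub>?N\<^esub> X = X"
      using f T.smult_one[of f] by (simp add: smult)
    assume "Y \<in> carrier ?N"
    then obtain g where g: "g \<in> carrier ?T" "Y = a_r_coset ?T ?I g" using carrierE by blast
    show "r \<odot>\<^bsub>?N\<^esub> (X \<oplus>\<^bsub>?N\<^esub> Y) = r \<odot>\<^bsub>?N\<^esub> X \<oplus>\<^bsub>?N\<^esub> r \<odot>\<^bsub>?N\<^esub> Y"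
      using f g T.smult_r_distr[of r f g] by (simp add: smult add smult_T)
  qed
  then show ?thesis
    unfolding vectorspace_def by (intro conjI class_field.field_axioms)
qed

end

theory Submission
  imports Defs
begin

text \<open>
  Write \<open>x\<close> for one of the two basis vectors, \<open>y\<close> for the other one, and \<open>c(x x) = s y y\<close>.  Everything
  rests on an explicit formula for the quantum symmetrizers: \<open>S\<^sub>n\<close> kills every word containing both
  letters, and
  \<open>S\<^sub>n(x\<^sup>n) = \<alpha>\<^sub>n (x\<^sup>n - t\<^sub>n(s) y\<^sup>n)\<close>, where \<open>t\<^sub>n(s)\<close> is \<open>(-s)\<^bsup>n/2\<^esup>\<close> for even \<open>n\<close> and \<open>0\<close> for odd \<open>n\<close>, and
  \<open>\<alpha>\<^sub>n\<close> is the product of the factors \<open>1 - t\<^sub>k(a) t\<^sub>k(e)\<close> for \<open>0 < k < n\<close>; such a factor is \<open>1\<close> for odd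
  \<open>k\<close> and \<open>1 - (ae)\<^bsup>k/2\<^esup>\<close> for even \<open>k\<close> (\<open>quantum_symmetrizer_abe\<close>).

  The formula follows by induction on \<open>n\<close>.  By induction, only the words \<open>x\<^sup>n x\<close> and \<open>x\<^sup>n y\<close> enter the
  quantum shuffle.  There the summands \<open>c\<^sub>i \<dots> c\<^sub>n\<close> telescope: they move the border between a block of
  \<open>x\<close> and a block of \<open>y\<close> to the left, and because \<open>b = -1\<close> each move by two places is followed by a
  sign change, so that consecutive summands cancel and only the words \<open>x\<^bsup>n+1\<^esup>\<close> and \<open>y\<^bsup>n+1\<^esup>\<close> survive
  (\<open>partial_shuffle_two_block\<close>).

  Now let \<open>ae\<close> be a primitive \<open>m\<close>-th root of unity.  Then \<open>\<alpha>\<^sub>n\<close> vanishes exactly for \<open>n > 2m\<close>.  For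
  \<open>1 \<le> n < 2m\<close> the images of \<open>x\<^sup>n\<close> and \<open>y\<^sup>n\<close> are independent, since \<open>t\<^sub>n(a) t\<^sub>n(e) \<noteq> 1\<close>, and for
  \<open>n = 2m\<close> they are proportional.  Hence the classes of the empty word, of the powers of both letters
  in the degrees \<open>1, \<dots>, 2m - 1\<close>, and of one power in degree \<open>2m\<close> form a basis, and the dimension is
  \<open>1 + 2(2m - 1) + 1 = 4m\<close>.
\<close>

section \<open>Linear operators and monomials\<close>

lemma linear_operator_lincomb:
  assumes "linear_operator A"
  shows "A (\<lambda>x. r * f x + s * g x) = (\<lambda>y. r * A f y + s * A g y)"
  using assms unfolding linear_operator_def by metis

lemma linear_operator_smult:
  assumes "linear_operator A"
  shows "A (\<lambda>x. r * f x) = (\<lambda>y. r * A f y)"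
  using assms unfolding linear_operator_def by metis

definition monomial :: "'i list \<Rightarrow> 'i list \<Rightarrow> 'k::field" where
  "monomial u = (\<lambda>w. if w = u then 1 else 0)"

fun flip :: "index2 \<Rightarrow> index2" where
  "flip I1 = I2"
| "flip I2 = I1"

fun square_coeff :: "'k \<Rightarrow> 'k \<Rightarrow> index2 \<Rightarrow> 'k" where
  "square_coeff a e I1 = a"
| "square_coeff a e I2 = e"

section \<open>The braiding on monomials\<close>

text \<open>
  The next two lemmas replace positions in a word by a splitting around the two letters on which the
  braiding acts, so that list updates disappear from all later computations.
\<close>

lemma braid_at_split:
  assumes "length u = i" "n = i + 2 + length v"
  shows "braid_at c n (Suc i) f (u @ [k, l] @ v) = c (\<lambda>(k, l). f (u @ [k, l] @ v)) (k, l)"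
  using assms by (simp add: braid_at_def list_update_append nth_append case_prod_unfold)

lemma list_split_at_pair:
  assumes "length w = i + 2 + j"
  obtains u k l v where "w = u @ [k, l] @ v" "length u = i" "length v = j"
proof
  show "w = take i w @ [w ! i, w ! Suc i] @ drop (i + 2) w"
    using assms by (simp add: Cons_nth_drop_Suc)
qed (use assms in auto)

lemma braid_at_monomial:
  assumes i: "length u = i" and n: "n = i + 2 + length v"
  shows "braid_at (braiding_abe a b e) n (Suc i) (monomial (u @ [x, x] @ v)) =
      (\<lambda>w. square_coeff a e x * monomial (u @ [flip x, flip x] @ v) w)" (is ?equal)
    and "x \<noteq> y \<Longrightarrow> braid_at (braiding_abe a b e) n (Suc i) (monomial (u @ [x, y] @ v)) =
      (\<lambda>w. b * monomial (u @ [x, y] @ v) w)" (is "_ \<Longrightarrow> ?distinct")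
proof -
  have ext_words: "F = G" if "\<And>w. length w \<noteq> n \<Longrightarrow> F w = G w"
    and "\<And>u' k l v'. length u' = i \<Longrightarrow> length v' = length v \<Longrightarrow>
      F (u' @ [k, l] @ v') = G (u' @ [k, l] @ v')" for F G :: "index2 list \<Rightarrow> 'a"
  proof
    show "F w = G w" for w
    proof (cases "length w = n")
      case True
      then show ?thesis
        using that(2) n by (metis list_split_at_pair)
    qed (rule that(1))
  qed
  have split: "monomial (u @ [x, y] @ v) (u' @ [k, l] @ v') =
      (if u' = u \<and> v' = v then basis_tensor x y (k, l) else 0 :: 'a)"
    if "length u' = i" for u' v' x y k l
    using that i by (auto simp: monomial_def basis_tensor_def)
  show ?equal
  proof (rule ext_words)
    fix u' v' :: "index2 list" and k l assume len: "length u' = i" "length v' = length v"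
    show "braid_at (braiding_abe a b e) n (Suc i) (monomial (u @ [x, x] @ v)) (u' @ [k, l] @ v') =
      square_coeff a e x * monomial (u @ [flip x, flip x] @ v) (u' @ [k, l] @ v')"
      unfolding split[OF len(1)] braid_at_split[OF len(1) n[folded len(2)]]
      by (cases x; cases k; cases l) (simp_all add: braiding_abe_apply basis_tensor_def)
  qed (use i n in \<open>auto simp: braid_at_def monomial_def\<close>)
  show ?distinct if "x \<noteq> y"
  proof (rule ext_words)
    fix u' v' :: "index2 list" and k l assume len: "length u' = i" "length v' = length v"
    show "braid_at (braiding_abe a b e) n (Suc i) (monomial (u @ [x, y] @ v)) (u' @ [k, l] @ v') =
      b * monomial (u @ [x, y] @ v) (u' @ [k, l] @ v')"
      unfolding split[OF len(1)] braid_at_split[OF len(1) n[folded len(2)]]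
      using that
      by (cases x; cases y; cases k; cases l) (simp_all add: braiding_abe_apply basis_tensor_def)
  qed (use i n in \<open>auto simp: braid_at_def monomial_def\<close>)
qed

text \<open>
  These words are closed, up to scalars, under all the braidings that a quantum shuffle applies to
  \<open>x\<^bsup>n+1\<^esup>\<close> and \<open>x\<^sup>n y\<close>.
\<close>

definition two_block :: "index2 \<Rightarrow> nat \<Rightarrow> nat \<Rightarrow> index2 list \<Rightarrow> 'k::field" where
  "two_block x p q = monomial (replicate p x @ replicate q (flip x))"

lemma flip_neq: "x \<noteq> flip x"
  by (cases x) auto

lemma braid_at_border:
  assumes "n = Suc p + Suc q"
  shows "braid_at (braiding_abe a b e) n (Suc p) (two_block x (Suc p) (Suc q)) =
    (\<lambda>w. b * two_block x (Suc p) (Suc q) w)"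
  using braid_at_monomial(2)[of "replicate p x" p n "replicate q (flip x)" x "flip x" a b e]
    flip_neq[of x] assms
  by (simp add: two_block_def replicate_app_Cons_same)

lemma braid_at_last_pair:
  assumes "n = Suc (Suc p) + q"
  shows "braid_at (braiding_abe a b e) n (Suc p) (two_block x (Suc (Suc p)) q) =
    (\<lambda>w. square_coeff a e x * two_block x p (Suc (Suc q)) w)"
  using braid_at_monomial(1)[of "replicate p x" p n "replicate q (flip x)" a b e x] assms
  by (simp add: two_block_def replicate_app_Cons_same)

section \<open>The quantum shuffle\<close>

text \<open>
  The sum \<open>id + c\<^sub>p + \<dots> + c\<^sub>1 \<dots> c\<^sub>p\<close> on a tensor power of degree \<open>N\<close> that may exceed \<open>p + 1\<close>.  Factoring
  out the operator that acts first gives \<open>R\<^sub>p = id + R\<^bsub>p-1\<^esub> c\<^sub>p\<close>; this recursion keeps \<open>N\<close> fixed while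
  \<open>p\<close> decreases, which the telescoping argument needs.
\<close>

primrec partial_shuffle ::
  "('i::finite, 'k::field) braiding \<Rightarrow> nat \<Rightarrow> nat \<Rightarrow> ('i list \<Rightarrow> 'k) \<Rightarrow> 'i list \<Rightarrow> 'k" where
  "partial_shuffle c N 0 f = f"
| "partial_shuffle c N (Suc p) f = (\<lambda>w. f w + partial_shuffle c N p (braid_at c N (Suc p) f) w)"

lemma partial_shuffle_eq:
  "partial_shuffle c N p f = (\<lambda>w. f w + (\<Sum>i = 1..p. foldr (braid_at c N) [i..<p + 1] f w))"
proof (induction p arbitrary: f)
  case (Suc p)
  show ?case
    by (auto simp: Suc intro!: sum.cong)
qed simp

lemma quantum_shuffle_eq_partial_shuffle: "quantum_shuffle c n = partial_shuffle c (n + 1) n"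
  by (simp add: fun_eq_iff quantum_shuffle_def partial_shuffle_eq)

lemma linear_operator_partial_shuffle:
  assumes "linear_operator c"
  shows "linear_operator (partial_shuffle c N p)"
proof (induction p)
  case (Suc p)
  have *: "braid_at c N (Suc p) (\<lambda>x. f x + g x) =
      (\<lambda>y. braid_at c N (Suc p) f y + braid_at c N (Suc p) g y)"
    "braid_at c N (Suc p) (\<lambda>x. r * f x) = (\<lambda>y. r * braid_at c N (Suc p) f y)" for f g r
    using linear_operator_braid_at[OF assms] unfolding linear_operator_def by blast+
  have **: "partial_shuffle c N p (\<lambda>x. f x + g x) =
      (\<lambda>y. partial_shuffle c N p f y + partial_shuffle c N p g y)"
    "partial_shuffle c N p (\<lambda>x. r * f x) = (\<lambda>y. r * partial_shuffle c N p f y)" for f g r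
    using Suc unfolding linear_operator_def by blast+
  show ?case
    unfolding linear_operator_def partial_shuffle.simps * ** by (simp add: distrib_left add_ac)
qed (simp add: linear_operator_def)

lemma linear_operator_abe: "linear_operator (braiding_abe a b e)"
  unfolding linear_operator_def braiding_abe_def
  by (auto simp: fun_eq_iff case_prod_unfold distrib_right sum.distrib sum_distrib_left mult.assoc)

text \<open>The scalar \<open>t\<^sub>n(s)\<close> in \<open>S\<^sub>n(x\<^sup>n) = \<alpha>\<^sub>n (x\<^sup>n - t\<^sub>n(s) y\<^sup>n)\<close>.\<close>

definition twist :: "'k::field \<Rightarrow> nat \<Rightarrow> 'k" where
  "twist s n = (if even n then (- s) ^ (n div 2) else 0)"

text \<open>
  The telescoping.  On \<open>x\<^sup>p y\<^bsup>q+1\<^esup>\<close> the operator \<open>c\<^sub>p\<close> acts at the border of the blocks as \<open>-1\<close>.  So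
  \<open>R\<^sub>p = id + R\<^bsub>p-1\<^esub> c\<^sub>p = id + c\<^sub>p + R\<^bsub>p-2\<^esub> c\<^bsub>p-1\<^esub> c\<^sub>p\<close> loses its first two terms, and since \<open>c\<^bsub>p-1\<^esub>\<close>
  turns the last pair \<open>x x\<close> into \<open>s y y\<close>, what remains is \<open>-s\<close> times the value of \<open>R\<^bsub>p-2\<^esub>\<close> on
  \<open>x\<^bsup>p-2\<^esup> y\<^bsup>q+3\<^esup>\<close>.  The descent ends with \<open>0\<close> at \<open>p = 1\<close> and with a power of \<open>y\<close> at \<open>p = 0\<close>.
\<close>

lemma partial_shuffle_two_block:
  assumes "N = p + Suc q"
  shows "partial_shuffle (braiding_abe a (- 1) e) N p (two_block x p (Suc q)) =
    (\<lambda>w. twist (square_coeff a e x) p * two_block x 0 N w)"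
  using assms
proof (induction p arbitrary: q rule: induct_nat_012)
  case 0
  then show ?case by (simp add: twist_def)
next
  case 1
  then show ?case by (simp add: braid_at_border twist_def fun_eq_iff)
next
  case (ge2 p)
  let ?s = "square_coeff a e x"
  let ?R = "partial_shuffle (braiding_abe a (- 1) e) N"
  note sm = linear_operator_smult[OF linear_operator_partial_shuffle[OF linear_operator_abe]]
  have border: "braid_at (braiding_abe a (- 1) e) N (Suc (Suc p)) (two_block x (Suc (Suc p)) (Suc q)) =
    (\<lambda>w. (- 1) * two_block x (Suc (Suc p)) (Suc q) w)"
    by (rule braid_at_border) (simp add: ge2.prems)
  have pair: "braid_at (braiding_abe a (- 1) e) N (Suc p) (two_block x (Suc (Suc p)) (Suc q)) =
    (\<lambda>w. ?s * two_block x p (Suc (Suc (Suc q))) w)"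
    by (rule braid_at_last_pair) (simp add: ge2.prems)
  have "?R (Suc (Suc p)) (two_block x (Suc (Suc p)) (Suc q)) =
    (\<lambda>w. - ?s * ?R p (two_block x p (Suc (Suc (Suc q)))) w)"
    by (simp only: partial_shuffle.simps(2)[of _ _ "Suc p"] border sm)
      (simp only: partial_shuffle.simps(2) pair sm, simp add: fun_eq_iff)
  also have "?R p (two_block x p (Suc (Suc (Suc q)))) = (\<lambda>w. twist ?s p * two_block x 0 N w)"
    by (rule ge2.IH(1)) (simp add: ge2.prems)
  finally show ?case
    by (simp add: twist_def fun_eq_iff)
qed

lemma quantum_shuffle_mixed:
  "quantum_shuffle (braiding_abe a (- 1) e) n (monomial (replicate n x @ [flip x])) =
    (\<lambda>w. twist (square_coeff a e x) n * monomial (replicate (Suc n) (flip x)) w)"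
  using partial_shuffle_two_block[of "Suc n" n 0 a e x]
  by (simp add: quantum_shuffle_eq_partial_shuffle two_block_def)

text \<open>
  For the word \<open>x\<^bsup>n+1\<^esup>\<close> there is no border at the start, so the identity term survives; after \<open>c\<^sub>n\<close> has
  created the block \<open>y y\<close>, the telescoping applies to the rest.
\<close>

lemma quantum_shuffle_power:
  assumes "n \<ge> 1"
  shows "quantum_shuffle (braiding_abe a (- 1) e) n (monomial (replicate n x @ [x])) =
    (\<lambda>w. monomial (replicate (Suc n) x) w
       - twist (square_coeff a e x) (Suc n) * monomial (replicate (Suc n) (flip x)) w)"
proof -
  obtain p where n: "n = Suc p" using assms by (cases n) auto
  let ?s = "square_coeff a e x"
  note sm = linear_operator_smult[OF linear_operator_partial_shuffle[OF linear_operator_abe]]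
  have mono: "monomial (replicate n x @ [x]) = two_block x (Suc (Suc p)) 0"
    by (simp add: two_block_def n replicate_append_same)
  have pair: "braid_at (braiding_abe a (- 1) e) (n + 1) (Suc p) (two_block x (Suc (Suc p)) 0) =
    (\<lambda>w. ?s * two_block x p (Suc (Suc 0)) w)"
    by (rule braid_at_last_pair) (simp add: n)
  have R: "partial_shuffle (braiding_abe a (- 1) e) (n + 1) p (two_block x p (Suc (Suc 0))) =
    (\<lambda>w. twist ?s p * two_block x 0 (n + 1) w)"
    by (rule partial_shuffle_two_block) (simp add: n)
  have "quantum_shuffle (braiding_abe a (- 1) e) n (two_block x (Suc (Suc p)) 0) =
    (\<lambda>w. two_block x (Suc (Suc p)) 0 w + ?s * (twist ?s p * two_block x 0 (n + 1) w))"
    unfolding quantum_shuffle_eq_partial_shuffle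
    by (subst (2) n) (simp only: partial_shuffle.simps(2) pair sm R)
  then show ?thesis
    unfolding mono by (simp add: twist_def two_block_def n fun_eq_iff)
qed

section \<open>The quantum symmetrizers\<close>

definition symmetrizer_factor :: "'k::field \<Rightarrow> 'k \<Rightarrow> nat \<Rightarrow> 'k" where
  "symmetrizer_factor a e n = (\<Prod>k = 1..<n. 1 - twist a k * twist e k)"

lemma symmetrizer_factor_Suc:
  "n \<ge> 1 \<Longrightarrow> symmetrizer_factor a e (Suc n) = symmetrizer_factor a e n * (1 - twist a n * twist e n)"
  by (simp add: symmetrizer_factor_def)

text \<open>
  Tensors are functions on words, so the formula for \<open>S\<^sub>n\<close> on words appears here in transposed form:
  the coefficient of \<open>x\<^sup>n\<close> in the image collects the contributions of \<open>x\<^sup>n\<close> and of \<open>y\<^sup>n\<close> in \<open>f\<close>.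

  In the induction step, an even \<open>n\<close> produces the new factor \<open>1 - t\<^sub>n(a) t\<^sub>n(e)\<close>, and the words
  \<open>x\<^sup>n y\<close> drop out because \<open>S\<^sub>n(x\<^sup>n)\<close> is a multiple of \<open>x\<^sup>n - t\<^sub>n(s) y\<^sup>n\<close>, which the shuffle with \<open>y\<close>
  annihilates.  For odd \<open>n\<close> the shuffle itself kills \<open>x\<^sup>n y\<close>, and it adds the opposite power to
  \<open>x\<^bsup>n+1\<^esup>\<close>.
\<close>

lemma quantum_symmetrizer_abe:
  assumes "n \<ge> 1" "f \<in> tensor_power n"
  shows "quantum_symmetrizer (braiding_abe a (- 1) e) n f =
    (\<lambda>w. symmetrizer_factor a e n *
      ((f (replicate n I1) - twist e n * f (replicate n I2)) * monomial (replicate n I1) w +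
       (f (replicate n I2) - twist a n * f (replicate n I1)) * monomial (replicate n I2) w))"
  using assms
proof (induction n arbitrary: f rule: nat_induct_at_least)
  case base
  have eq: "f w = f [I1] * monomial [I1] w + f [I2] * monomial [I2] w" for w
  proof (cases "length w = 1")
    case True
    then obtain x where "w = [x]" by (auto simp: length_Suc_conv)
    then show ?thesis by (cases x) (auto simp: monomial_def)
  next
    case False
    then have "f w = 0" using base by (auto simp: tensor_power_def)
    with False show ?thesis by (auto simp: monomial_def)
  qed
  show ?case
    by (rule ext, simp add: symmetrizer_factor_def twist_def) (rule eq)
next
  case (Suc n)
  let ?c = "braiding_abe a (- 1) e"
  let ?\<alpha> = "symmetrizer_factor a e n"
  let ?m = "\<lambda>x y. monomial (replicate n x @ [y]) :: index2 list \<Rightarrow> 'a"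
  let ?f = "\<lambda>x y. f (replicate n x @ [y])"
  \<comment> \<open>\<open>A y\<close> and \<open>B y\<close> are the coefficients of \<open>v\<^sub>1\<^sup>n y\<close> and \<open>v\<^sub>2\<^sup>n y\<close> after \<open>S\<^sub>n \<otimes> id\<close>\<close>
  define A where "A y = ?\<alpha> * (?f I1 y - twist e n * ?f I2 y)" for y
  define B where "B y = ?\<alpha> * (?f I2 y - twist a n * ?f I1 y)" for y
  have IH: "quantum_symmetrizer ?c n (\<lambda>u. f (u @ [y])) =
      (\<lambda>u. A y * monomial (replicate n I1) u + B y * monomial (replicate n I2) u)" for y
  proof -
    have "(\<lambda>u. f (u @ [y])) \<in> tensor_power n"
      using Suc.prems by (auto simp: tensor_power_def)
    then show ?thesis
      unfolding A_def B_def by (simp add: Suc.IH algebra_simps)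
  qed
  have snoc: "?m x y w = (if w \<noteq> [] \<and> last w = y then monomial (replicate n x) (butlast w) else 0)"
    for x y w
    by (cases w rule: rev_cases) (auto simp: monomial_def)
  have tensor: "tensor_id (quantum_symmetrizer ?c n) f =
      (\<lambda>w. 1 * (A I1 * ?m I1 I1 w + A I2 * ?m I1 I2 w) + 1 * (B I1 * ?m I2 I1 w + B I2 * ?m I2 I2 w))"
  proof
    show "tensor_id (quantum_symmetrizer ?c n) f w =
      1 * (A I1 * ?m I1 I1 w + A I2 * ?m I1 I2 w) + 1 * (B I1 * ?m I2 I1 w + B I2 * ?m I2 I2 w)" for w
      by (cases "last w") (auto simp: tensor_id_def IH snoc)
  qed
  have step: "quantum_symmetrizer ?c (Suc n) f =
      quantum_shuffle ?c n (tensor_id (quantum_symmetrizer ?c n) f)"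
    using Suc.hyps by (cases n) auto
  note lc = linear_operator_lincomb[OF linear_operator_quantum_shuffle[OF linear_operator_abe]]
  have power: "replicate n x @ [x] = replicate (Suc n) x" for x :: index2
    by (simp add: replicate_append_same)
  note mixed = quantum_shuffle_mixed[of a e n I1] quantum_shuffle_mixed[of a e n I2]
  note pow = quantum_shuffle_power[OF Suc.hyps, of a e I1] quantum_shuffle_power[OF Suc.hyps, of a e I2]
  have twist_0: "even n \<Longrightarrow> twist s (Suc n) = 0" "odd n \<Longrightarrow> twist s n = 0" for s :: 'a
    by (simp_all add: twist_def)
  \<comment> \<open>one of \<open>n\<close> and \<open>n + 1\<close> is odd, so in each case half of the terms vanish\<close>
  have coeff1: "A I1 + B I1 * twist e n - B I2 * twist e (Suc n) =
      symmetrizer_factor a e (Suc n) * (?f I1 I1 - twist e (Suc n) * ?f I2 I2)"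
    by (cases "even n")
      (simp_all add: A_def B_def symmetrizer_factor_Suc[OF Suc.hyps] twist_0 algebra_simps)
  have coeff2: "B I2 + A I2 * twist a n - A I1 * twist a (Suc n) =
      symmetrizer_factor a e (Suc n) * (?f I2 I2 - twist a (Suc n) * ?f I1 I1)"
    by (cases "even n")
      (simp_all add: A_def B_def symmetrizer_factor_Suc[OF Suc.hyps] twist_0 algebra_simps)
  have "quantum_symmetrizer ?c (Suc n) f = (\<lambda>w.
      (A I1 + B I1 * twist e n - B I2 * twist e (Suc n)) * monomial (replicate (Suc n) I1) w +
      (B I2 + A I2 * twist a n - A I1 * twist a (Suc n)) * monomial (replicate (Suc n) I2) w)"
    unfolding step tensor lc mixed[unfolded flip.simps] pow[unfolded flip.simps]
    by (simp add: fun_eq_iff algebra_simps del: replicate.simps)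
  then show ?case
    unfolding coeff1 coeff2 power by (simp add: algebra_simps del: replicate.simps)
qed

section \<open>Dimensions of Nichols algebras from normal forms\<close>

lemma nichols_ideal_lincomb:
  assumes c: "linear_operator c" and f: "f \<in> nichols_ideal c" and g: "g \<in> nichols_ideal c"
  shows "(\<lambda>w. r * f w + s * g w) \<in> nichols_ideal c"
proof -
  have "finite {w. r * f w + s * g w \<noteq> 0}"
  proof (rule finite_subset)
    show "{w. r * f w + s * g w \<noteq> 0} \<subseteq> {w. f w \<noteq> 0} \<union> {w. g w \<noteq> 0}" by auto
    show "finite ({w. f w \<noteq> 0} \<union> {w. g w \<noteq> 0})"
      using f g by (simp add: nichols_ideal_def tensor_algebra_def)
  qed
  moreover have "quantum_symmetrizer c n (homogeneous_part n (\<lambda>w. r * f w + s * g w)) = (\<lambda>w. 0)" for n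
  proof -
    have "homogeneous_part n (\<lambda>w. r * f w + s * g w) =
        (\<lambda>w. r * homogeneous_part n f w + s * homogeneous_part n g w)"
      by (auto simp: homogeneous_part_def)
    then show ?thesis
      using f g linear_operator_lincomb[OF linear_operator_quantum_symmetrizer[OF c]]
      by (simp add: nichols_ideal_def)
  qed
  ultimately show ?thesis
    by (simp add: nichols_ideal_def tensor_algebra_def)
qed

lemma zero_in_nichols_ideal:
  assumes "linear_operator c"
  shows "(\<lambda>w. 0) \<in> nichols_ideal c"
  using linear_operator_smult[OF linear_operator_quantum_symmetrizer[OF assms], of _ 0 "\<lambda>w. 0"]
  by (simp add: nichols_ideal_def tensor_algebra_def homogeneous_part_def)

abbreviation nichols_class ::
  "('i::finite, 'k::field) braiding \<Rightarrow> ('i list \<Rightarrow> 'k) \<Rightarrow> ('i list \<Rightarrow> 'k) set" where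
  "nichols_class c \<equiv> a_r_coset tensor_algebra (nichols_ideal c)"

lemma in_nichols_class_iff: "h \<in> nichols_class c f \<longleftrightarrow> (\<lambda>w. h w - f w) \<in> nichols_ideal c"
proof -
  have "h \<in> nichols_class c f \<longleftrightarrow> (\<exists>g\<in>nichols_ideal c. h = (\<lambda>w. g w + f w))"
    by (auto simp: a_r_coset_def' tensor_algebra_def)
  also have "\<dots> \<longleftrightarrow> (\<lambda>w. h w - f w) \<in> nichols_ideal c"
  proof
    assume "(\<lambda>w. h w - f w) \<in> nichols_ideal c"
    then show "\<exists>g\<in>nichols_ideal c. h = (\<lambda>w. g w + f w)"
      by (rule rev_bexI) simp
  qed auto
  finally show ?thesis .
qed

lemma nichols_class_eq_iff:
  assumes c: "linear_operator c"
  shows "nichols_class c f = nichols_class c g \<longleftrightarrow> (\<lambda>w. f w - g w) \<in> nichols_ideal c"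
proof
  assume "nichols_class c f = nichols_class c g"
  moreover have "f \<in> nichols_class c f"
    by (simp add: in_nichols_class_iff zero_in_nichols_ideal[OF c])
  ultimately show "(\<lambda>w. f w - g w) \<in> nichols_ideal c"
    by (simp add: in_nichols_class_iff)
next
  assume *: "(\<lambda>w. f w - g w) \<in> nichols_ideal c"
  show "nichols_class c f = nichols_class c g"
  proof (intro Set.set_eqI iffI)
    fix h assume "h \<in> nichols_class c f"
    then show "h \<in> nichols_class c g"
      using nichols_ideal_lincomb[OF c _ *, of "\<lambda>w. h w - f w" 1 1]
      by (simp add: in_nichols_class_iff)
  next
    fix h assume "h \<in> nichols_class c g"
    then show "h \<in> nichols_class c f"
      using nichols_ideal_lincomb[OF c _ *, of "\<lambda>w. h w - g w" 1 "- 1"]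
      by (simp add: in_nichols_class_iff)
  qed
qed

lemma nichols_class_add:
  assumes c: "linear_operator c"
  shows "nichols_class c f \<oplus>\<^bsub>nichols_algebra c\<^esub> nichols_class c g = nichols_class c (\<lambda>w. f w + g w)"
    (is "?L = ?R")
proof (intro Set.set_eqI iffI)
  have L: "h \<in> ?L \<longleftrightarrow> (\<exists>f'\<in>nichols_class c f. \<exists>g'\<in>nichols_class c g. h = (\<lambda>w. f' w + g' w))" for h
    by (auto simp: nichols_algebra_simps set_add_def' tensor_algebra_def)
  fix h
  show "h \<in> ?R" if "h \<in> ?L"
  proof -
    from that obtain f' g' where
      "f' \<in> nichols_class c f" "g' \<in> nichols_class c g" "h = (\<lambda>w. f' w + g' w)"
      unfolding L by blast
    then have *: "(\<lambda>w. f' w - f w) \<in> nichols_ideal c" "(\<lambda>w. g' w - g w) \<in> nichols_ideal c"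
      "h = (\<lambda>w. f' w + g' w)"
      by (simp_all only: in_nichols_class_iff)
    have "(\<lambda>w. h w - (f w + g w)) = (\<lambda>w. 1 * (f' w - f w) + 1 * (g' w - g w))"
      by (simp add: *(3) algebra_simps)
    then show ?thesis
      using nichols_ideal_lincomb[OF c *(1,2)] by (simp only: in_nichols_class_iff)
  qed
  show "h \<in> ?L" if "h \<in> ?R"
    unfolding L in_nichols_class_iff
  proof (intro bexI)
    show "h = (\<lambda>w. (h w - g w) + g w)" by simp
    show "(\<lambda>w. g w) \<in> nichols_class c g"
      by (simp add: in_nichols_class_iff zero_in_nichols_ideal[OF c])
    show "(\<lambda>w. h w - g w) \<in> nichols_class c f"
      using that by (simp add: in_nichols_class_iff algebra_simps)
  qed
qed

lemma nichols_class_smult: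
  assumes c: "linear_operator c"
  shows "r \<odot>\<^bsub>nichols_algebra c\<^esub> nichols_class c f = nichols_class c (\<lambda>w. r * f w)"
proof -
  have "nichols_class c (r \<odot>\<^bsub>tensor_algebra\<^esub> g) = nichols_class c (\<lambda>w. r * f w)"
    if "g \<in> nichols_class c f" for g
  proof -
    have "(\<lambda>w. r * (g w - f w) + 0 * (g w - f w)) \<in> nichols_ideal c"
      using that by (intro nichols_ideal_lincomb[OF c]) (simp_all add: in_nichols_class_iff)
    then have "nichols_class c (\<lambda>w. r * g w) = nichols_class c (\<lambda>w. r * f w)"
      by (simp add: nichols_class_eq_iff[OF c] right_diff_distrib)
    moreover have "r \<odot>\<^bsub>tensor_algebra\<^esub> g = (\<lambda>w. r * g w)"
      by (simp add: tensor_algebra_def)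
    ultimately show ?thesis by simp
  qed
  moreover have "f \<in> nichols_class c f"
    by (simp add: in_nichols_class_iff zero_in_nichols_ideal[OF c])
  ultimately show ?thesis
    unfolding nichols_algebra_simps by (intro UN_constant_eq) auto
qed

text \<open>
  If every tensor is congruent to exactly one tensor supported on the words in \<open>J\<close>, then the map sending
  a coordinate vector indexed by \<open>J\<close> to the class of the corresponding tensor is a linear isomorphism.
\<close>

lemma nichols_algebra_dim:
  fixes c :: "('i::finite, 'k::field) braiding"
  assumes c: "linear_operator c" and J: "finite J"
    and reduce: "\<And>f. finite {w. f w \<noteq> 0} \<Longrightarrow>
      \<exists>g. (\<forall>w. w \<notin> J \<longrightarrow> g w = 0) \<and> (\<lambda>w. f w - g w) \<in> nichols_ideal c"
    and indep: "\<And>g. (\<forall>w. w \<notin> J \<longrightarrow> g w = 0) \<Longrightarrow> g \<in> nichols_ideal c \<Longrightarrow> g = (\<lambda>w. 0)"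
  shows "vectorspace.fin_dim class_ring (nichols_algebra c) \<and>
    vectorspace.dim class_ring (nichols_algebra c) = card J"
proof -
  let ?N = "nichols_algebra c"
  let ?V = "module_vec TYPE('k) (card J)"
  obtain idx where idx: "bij_betw idx J {0..<card J}"
    using ex_bij_betw_finite_nat[OF J] by blast
  define form where "form v = (\<lambda>w. if w \<in> J then v $ idx w else 0)" for v :: "'k vec"
  define T where "T v = nichols_class c (form v)" for v
  have idx_less: "idx w < card J" if "w \<in> J" for w
    using bij_betwE[OF idx] that by auto
  have form_in: "form v \<in> carrier tensor_algebra" for v
  proof -
    have "finite {w. form v w \<noteq> 0}"
      by (rule finite_subset[OF _ J]) (auto simp: form_def)
    then show ?thesis by (simp add: tensor_algebra_def)
  qed
  have form_add: "form (u + v) = (\<lambda>w. form u w + form v w)"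
    if "u \<in> carrier_vec (card J)" "v \<in> carrier_vec (card J)" for u v
    using that by (auto simp: form_def idx_less)
  have form_smult: "form (r \<cdot>\<^sub>v v) = (\<lambda>w. r * form v w)" if "v \<in> carrier_vec (card J)" for r v
    using that by (auto simp: form_def idx_less)
  interpret V: vec_space "TYPE('k)" "card J" .
  interpret N: vectorspace class_ring ?N
    by (rule vectorspace_nichols_algebra[OF c])
  have T_in: "T v \<in> carrier ?N" for v
    unfolding T_def nichols_algebra_simps A_RCOSETS_def' using form_in by blast
  have hom: "T \<in> LinearCombinations.module_hom class_ring ?V ?N"
    using T_in
    by (auto simp: LinearCombinations.module_hom_def module_vec_simps T_def form_add form_smult
      nichols_class_add[OF c] nichols_class_smult[OF c])
  interpret T: linear_map class_ring ?V ?N T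
    by unfold_locales (rule hom)
  have class_zero: "nichols_class c (\<lambda>w. 0) = \<zero>\<^bsub>?N\<^esub>"
    by (auto simp: in_nichols_class_iff nichols_algebra_simps)
  have inj: "inj_on T (carrier ?V)"
  proof (rule inj_onI)
    fix u v assume uv: "u \<in> carrier ?V" "v \<in> carrier ?V" and "T u = T v"
    then have "(\<lambda>w. form u w - form v w) \<in> nichols_ideal c"
      by (simp add: T_def nichols_class_eq_iff[OF c])
    then have "(\<lambda>w. form u w - form v w) = (\<lambda>w. 0)"
      by (rule indep[rotated]) (simp add: form_def)
    then have *: "form u w = form v w" for w
      by (simp add: fun_eq_iff)
    show "u = v"
    proof (rule eq_vecI)
      fix i assume "i < dim_vec v"
      then have "i \<in> idx ` J"
        using uv idx by (simp add: module_vec_simps bij_betw_def)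
      then obtain w where "w \<in> J" "i = idx w" by blast
      then show "u $ i = v $ i" using *[of w] by (simp add: form_def)
    qed (use uv in \<open>auto simp: module_vec_simps\<close>)
  qed
  have surj: "T ` carrier ?V = carrier ?N"
  proof
    show "T ` carrier ?V \<subseteq> carrier ?N"
      using hom by (auto simp: LinearCombinations.module_hom_def)
    show "carrier ?N \<subseteq> T ` carrier ?V"
    proof
      fix X assume "X \<in> carrier ?N"
      then obtain f where f: "finite {w. f w \<noteq> 0}" "X = nichols_class c f"
        by (auto simp: nichols_algebra_simps A_RCOSETS_def' tensor_algebra_def)
      from reduce[OF f(1)] obtain g
        where g: "\<forall>w. w \<notin> J \<longrightarrow> g w = 0" "(\<lambda>w. f w - g w) \<in> nichols_ideal c"
        by blast
      define v where "v = vec (card J) (\<lambda>i. g (inv_into J idx i))"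
      have "form v = g"
        using g(1) idx by (auto simp: form_def v_def idx_less bij_betw_def)
      then have "X = T v"
        using g(2) by (simp add: T_def f(2) nichols_class_eq_iff[OF c])
      then show "X \<in> T ` carrier ?V"
        by (auto simp: module_vec_simps v_def)
    qed
  qed
  show ?thesis
    using T.surj_fin_dim[OF V.fin_dim surj] T.dim_eq[OF V.fin_dim inj surj] V.dim_is_n by simp
qed

section \<open>The Nichols algebra of the braiding\<close>

lemma twist_mult: "twist a n * twist e n = (if even n then (a * e) ^ (n div 2) else 0)"
  by (simp add: twist_def flip: power_mult_distrib)

lemma twist_mult_eq_1_iff:
  assumes "primitive_root_of_unity m (a * e)" "1 \<le> n" "n \<le> 2 * m"
  shows "twist a n * twist e n = 1 \<longleftrightarrow> n = 2 * m"
proof (cases "even n")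
  case True
  then obtain k where k: "n = 2 * k" by blast
  show ?thesis
    using assms by (cases "k = m") (auto simp: twist_mult k primitive_root_of_unity_def)
next
  case False
  then show ?thesis by (auto simp: twist_mult)
qed

text \<open>
  The product runs over \<open>k < n\<close>, and the first vanishing factor is the one for \<open>k = 2m\<close>.
\<close>

lemma symmetrizer_factor_eq_0_iff:
  assumes m: "primitive_root_of_unity m (a * e)"
  shows "symmetrizer_factor a e n = 0 \<longleftrightarrow> 2 * m < n"
proof -
  have m1: "1 \<le> m" using m by (simp add: primitive_root_of_unity_def)
  have "symmetrizer_factor a e n = 0 \<longleftrightarrow> (\<exists>k\<in>{1..<n}. twist a k * twist e k = 1)"
    by (auto simp: symmetrizer_factor_def)
  also have "\<dots> \<longleftrightarrow> 2 * m < n"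
  proof
    assume "\<exists>k\<in>{1..<n}. twist a k * twist e k = 1"
    then obtain k where k: "1 \<le> k" "k < n" "twist a k * twist e k = 1" by auto
    show "2 * m < n"
      using twist_mult_eq_1_iff[OF m k(1)] k by (cases "k \<le> 2 * m") auto
  next
    assume "2 * m < n"
    then show "\<exists>k\<in>{1..<n}. twist a k * twist e k = 1"
      using twist_mult_eq_1_iff[OF m, of "2 * m"] m1 by (intro bexI[of _ "2 * m"]) auto
  qed
  finally show ?thesis .
qed

text \<open>
  Above degree \<open>2m\<close> the symmetrizer is zero and imposes no condition.  In the degrees \<open>1, \<dots>, 2m\<close> the
  factor \<open>\<alpha>\<^sub>n\<close> is invertible, so the kernel of \<open>S\<^sub>n\<close> is cut out by the vanishing of the two remaining
  coefficients.
\<close>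

lemma in_nichols_ideal_abe_iff:
  assumes m: "primitive_root_of_unity m (a * e)"
  shows "f \<in> nichols_ideal (braiding_abe a (- 1) e) \<longleftrightarrow>
    finite {w. f w \<noteq> 0} \<and> f [] = 0 \<and>
    (\<forall>n. 1 \<le> n \<and> n \<le> 2 * m \<longrightarrow>
      f (replicate n I1) = twist e n * f (replicate n I2) \<and>
      f (replicate n I2) = twist a n * f (replicate n I1))"
proof -
  have degree_0: "quantum_symmetrizer (braiding_abe a (- 1) e) 0 (homogeneous_part 0 f) = (\<lambda>w. 0)
      \<longleftrightarrow> f [] = 0"
    by (auto simp: homogeneous_part_def fun_eq_iff)
  have degree_pos: "quantum_symmetrizer (braiding_abe a (- 1) e) n (homogeneous_part n f) = (\<lambda>w. 0)
      \<longleftrightarrow> (n \<le> 2 * m \<longrightarrow>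
        f (replicate n I1) = twist e n * f (replicate n I2) \<and>
        f (replicate n I2) = twist a n * f (replicate n I1))" if n: "1 \<le> n" for n
  proof -
    have hom: "homogeneous_part n f \<in> tensor_power n"
      by (auto simp: homogeneous_part_def tensor_power_def)
    have neq: "replicate n I1 \<noteq> replicate n I2"
      using n by (cases n) auto
    have lin_indep: "(\<lambda>w. \<alpha> * (r * monomial (replicate n I1) w + s * monomial (replicate n I2) w))
        = (\<lambda>w. 0) \<longleftrightarrow> \<alpha> = 0 \<or> r = 0 \<and> s = 0" (is "?L = _ \<longleftrightarrow> _") for \<alpha> r s :: 'a
    proof
      assume "?L = (\<lambda>w. 0)"
      from fun_cong[OF this, of "replicate n I1"] fun_cong[OF this, of "replicate n I2"]
      show "\<alpha> = 0 \<or> r = 0 \<and> s = 0"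
        using neq by (auto simp: monomial_def)
    qed auto
    show ?thesis
      unfolding quantum_symmetrizer_abe[OF n hom] lin_indep symmetrizer_factor_eq_0_iff[OF m]
      by (auto simp: homogeneous_part_def)
  qed
  have "(\<forall>n. P n) \<longleftrightarrow> P 0 \<and> (\<forall>n. 1 \<le> n \<longrightarrow> P n)" for P :: "nat \<Rightarrow> bool"
    by (metis less_one not_le)
  note split = this[of "\<lambda>n. quantum_symmetrizer (braiding_abe a (- 1) e) n (homogeneous_part n f) = (\<lambda>w. 0)"]
  show ?thesis
    unfolding nichols_ideal_def mem_Collect_eq split degree_0
    using degree_pos by (auto simp: tensor_algebra_def)
qed

text \<open>
  The words whose classes form a basis.  In the top degree \<open>2m\<close> only \<open>v\<^sub>1\<^bsup>2m\<^esup>\<close> is listed, because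
  the class of \<open>v\<^sub>2\<^bsup>2m\<^esup>\<close> is a multiple of its class.
\<close>

definition power_words :: "nat \<Rightarrow> index2 list set" where
  "power_words m = insert [] ((\<lambda>(n, x). replicate n x) ` ({1..<2 * m} \<times> UNIV) \<union> {replicate (2 * m) I1})"

lemma card_power_words:
  assumes "m \<ge> 1"
  shows "finite (power_words m)" "card (power_words m) = 4 * m"
proof -
  let ?P = "(\<lambda>(n, x :: index2). replicate n x) ` ({1..<2 * m} \<times> UNIV)"
  have "inj_on (\<lambda>(n, x :: index2). replicate n x) ({1..<2 * m} \<times> UNIV)"
    by (auto simp: inj_on_def)
  then have "card ?P = 2 * (2 * m - 1)"
    by (simp add: card_image card_cartesian_product UNIV_index2)
  moreover have "replicate (2 * m) I1 \<notin> ?P"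
    by auto
  moreover have "[] \<notin> insert (replicate (2 * m) I1) ?P"
    using assms by auto
  moreover have "finite ?P" by simp
  ultimately show "finite (power_words m)" "card (power_words m) = 4 * m"
    using assms by (simp_all add: power_words_def)
qed

theorem theorem2p14:
  fixes a b e :: "'k::field" and m :: nat
  assumes "a \<noteq> 0" and "e \<noteq> 0" and "b = - 1" and "b\<^sup>2 \<noteq> a * e"
    and "m \<ge> 1" and "primitive_root_of_unity m (a * e)"
  shows "vectorspace.fin_dim class_ring (nichols_algebra (braiding_abe a b e)) \<and>
    vectorspace.dim class_ring (nichols_algebra (braiding_abe a b e)) = 4 * m"
proof -
  let ?I = "nichols_ideal (braiding_abe a b e)"
  let ?top = "\<lambda>x. replicate (2 * m) x :: index2 list"
  note root = \<open>primitive_root_of_unity m (a * e)\<close>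
  note ideal_iff = in_nichols_ideal_abe_iff[OF root, folded \<open>b = - 1\<close>]
  have low: "replicate n x \<in> power_words m" if "n < 2 * m" for n x
    using that by (cases "n = 0") (auto simp: power_words_def image_iff)
  have top1: "?top I1 \<in> power_words m"
    by (simp add: power_words_def)
  have top2: "?top I2 \<notin> power_words m"
    using \<open>m \<ge> 1\<close> by (auto simp: power_words_def)
  have twist_top: "twist a (2 * m) * twist e (2 * m) = 1"
    using twist_mult_eq_1_iff[OF root, of "2 * m"] \<open>m \<ge> 1\<close> by simp
  have "vectorspace.fin_dim class_ring (nichols_algebra (braiding_abe a b e)) \<and>
    vectorspace.dim class_ring (nichols_algebra (braiding_abe a b e)) = card (power_words m)"
  proof (rule nichols_algebra_dim[OF linear_operator_abe card_power_words(1)[OF \<open>m \<ge> 1\<close>]])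
    fix f :: "index2 list \<Rightarrow> 'k" assume f: "finite {w. f w \<noteq> 0}"
    \<comment> \<open>the correction in the top degree expresses \<open>v\<^sub>2\<^bsup>2m\<^esup>\<close> by \<open>v\<^sub>1\<^bsup>2m\<^esup>\<close> modulo the ideal\<close>
    define g where "g w = (if w \<in> power_words m
      then f w - (if w = ?top I1 then twist e (2 * m) * f (?top I2) else 0) else 0)" for w
    have "finite {w. f w - g w \<noteq> 0}"
    proof (rule finite_subset)
      show "{w. f w - g w \<noteq> 0} \<subseteq> {w. f w \<noteq> 0} \<union> power_words m" by (auto simp: g_def)
    qed (use f card_power_words(1)[OF \<open>m \<ge> 1\<close>] in simp)
    moreover have below: "f (replicate n x) - g (replicate n x) = 0" if "n < 2 * m" for n x
      using low[OF that, of x] that by (auto simp: g_def)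
    moreover have "f [] - g [] = 0"
      using below[of 0] \<open>m \<ge> 1\<close> by simp
    moreover have "f (replicate n I1) - g (replicate n I1) =
          twist e n * (f (replicate n I2) - g (replicate n I2)) \<and>
        f (replicate n I2) - g (replicate n I2) =
          twist a n * (f (replicate n I1) - g (replicate n I1))" if "n \<le> 2 * m" for n
    proof (cases "n = 2 * m")
      case True
      have "twist a (2 * m) * (twist e (2 * m) * f (?top I2)) = f (?top I2)"
        using twist_top by (simp flip: mult.assoc)
      then show ?thesis
        using top1 top2 by (simp add: True g_def)
    next
      case False
      with that have "n < 2 * m" by simp
      then show ?thesis by (simp only: below mult_zero_right)
    qed
    ultimately have "(\<lambda>w. f w - g w) \<in> ?I"
      unfolding ideal_iff by blast
    moreover have "\<forall>w. w \<notin> power_words m \<longrightarrow> g w = 0" by (simp add: g_def)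
    ultimately show "\<exists>g. (\<forall>w. w \<notin> power_words m \<longrightarrow> g w = 0) \<and> (\<lambda>w. f w - g w) \<in> ?I"
      by blast
  next
    fix g :: "index2 list \<Rightarrow> 'k"
    assume supp: "\<forall>w. w \<notin> power_words m \<longrightarrow> g w = 0" and "g \<in> ?I"
    then have nil: "g [] = 0"
      and rel: "\<And>n. 1 \<le> n \<Longrightarrow> n \<le> 2 * m \<Longrightarrow> g (replicate n I1) = twist e n * g (replicate n I2)"
        "\<And>n. 1 \<le> n \<Longrightarrow> n \<le> 2 * m \<Longrightarrow> g (replicate n I2) = twist a n * g (replicate n I1)"
      unfolding ideal_iff by blast+
    have low_0: "g (replicate n x) = 0" if n: "1 \<le> n" "n < 2 * m" for n x
    proof -
      have "(1 - twist a n * twist e n) * g (replicate n x) = 0"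
        using rel[of n] n by (cases x) (simp_all add: algebra_simps)
      then show ?thesis
        using twist_mult_eq_1_iff[OF root, of n] n by simp
    qed
    have top_0: "g (?top I1) = 0"
      using rel(1)[of "2 * m"] supp top2 \<open>m \<ge> 1\<close> by simp
    show "g = (\<lambda>w. 0)"
    proof
      show "g w = 0" for w
      proof (cases "w \<in> power_words m")
        case True
        then show ?thesis
          using nil low_0 top_0 unfolding power_words_def by auto
      qed (use supp in blast)
    qed
  qed
  then show ?thesis
    by (simp add: card_power_words(2)[OF \<open>m \<ge> 1\<close>])
qed

end
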